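(* Let $\epsilon$ and $\delta$ be real numbers with $0<\epsilon<\frac{2}{5}$ and $0<\delta\le\frac{1}{20}$, and let $\tau$ be a positive integer. Suppose that $\Gamma$ is a connected $D$-regular graph on $n$ vertices such that $\|Q^{\tau}_v-U\|<2\delta$ for at least $\epsilon n$ vertices $v$. Then every vertex set $X\subseteq V(\Gamma)$ with $4\delta n\le|X|\le\frac12 n$ satisfies $e(X,V(\Gamma)\setminus X)\ge\frac{\epsilon D}{8\tau}|X|$.
   Context: All graphs are finite simple graphs; $D\ge1$. The random walk on $\Gamma$ moves at each step to a uniformly random neighbor of the current vertex, independently of the history; $Q^t_v$ denotes the distribution of the position after $t$ steps of the walk started at $v$. $U$ is the uniform distribution on $V(\Gamma)$, and $\|P_1-P_2\|=\max_{A}|P_1(A)-P_2(A)|$ is the total variation distance. $e(X,Y)$ is the number of edges with one endpoint in $X$ and the other in $Y$. *)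

theory Defs
  imports "HOL-Probability.Probability" "Graph_Theory.Graph_Theory"
begin

text \<open>A finite simple graph is a \<open>pair_graph\<close>: a finite, loop-free, symmetric set of ordered pairs.
  Each undirected edge is thus represented by two opposite arcs; \<open>ugraph_edges\<close> recovers the
  edges as two-element sets, so that each of them is counted once.\<close>

definition neighbours :: "'a pair_pre_digraph \<Rightarrow> 'a \<Rightarrow> 'a set" where
  "neighbours G v = {w. (v, w) \<in> parcs G}"

definition regular :: "'a pair_pre_digraph \<Rightarrow> nat \<Rightarrow> bool" where
  "regular G D \<longleftrightarrow> (\<forall>v\<in>pverts G. card (neighbours G v) = D)"

definition ugraph_edges :: "'a pair_pre_digraph \<Rightarrow> 'a set set" where
  "ugraph_edges G = {{u, v} | u v. (u, v) \<in> parcs G}"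

definition edges_between :: "'a pair_pre_digraph \<Rightarrow> 'a set \<Rightarrow> 'a set \<Rightarrow> nat" where
  "edges_between G X Y = card {e \<in> ugraph_edges G. \<exists>x\<in>X. \<exists>y\<in>Y. e = {x, y}}"

text \<open>\<open>walk_pmf G t v\<close> is the law of the position after \<open>t\<close> steps of the random walk
  started at \<open>v\<close>. It is meaningful only if the vertices visited have a neighbour, since
  \<open>pmf_of_set {}\<close> is unspecified.\<close>

primrec walk_pmf :: "'a pair_pre_digraph \<Rightarrow> nat \<Rightarrow> 'a \<Rightarrow> 'a pmf" where
  "walk_pmf G 0 v = return_pmf v"
| "walk_pmf G (Suc t) v = bind_pmf (walk_pmf G t v) (\<lambda>u. pmf_of_set (neighbours G u))"

definition tv_dist :: "'a set \<Rightarrow> 'a pmf \<Rightarrow> 'a pmf \<Rightarrow> real" where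
  "tv_dist V P Q = Max ((\<lambda>A. \<bar>measure_pmf.prob P A - measure_pmf.prob Q A\<bar>) ` Pow V)"

end

theory Submission
  imports Defs
begin

text \<open>The uniform distribution is stationary, so the expected number of the first \<open>\<tau>\<close> steps at which
  a walk from a uniformly random vertex leaves \<open>X\<close> is \<open>\<tau>\<close> times \<open>e(X, V - X) / (D n)\<close>. Hence the
  probabilities of starting in \<open>X\<close> and ending outside, summed over the starting vertices, are at
  most \<open>\<tau> e(X, V - X) / D\<close>; the same holds with \<open>X\<close> and its complement exchanged. On the other
  hand, from each of the \<open>\<epsilon> n\<close> well-mixing vertices the walk ends on the opposite side of the cut
  with probability at least \<open>\<bar>X\<bar> / (2 n)\<close>.\<close>

lemma measure_bind_pmf_finite:
  assumes "finite V" "set_pmf p \<subseteq> V"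
  shows "measure_pmf.prob (bind_pmf p f) A = (\<Sum>u\<in>V. pmf p u * measure_pmf.prob (f u) A)"
proof -
  have "measure_pmf.prob (bind_pmf p f) A = measure_pmf.expectation p (\<lambda>u. measure_pmf.prob (f u) A)"
    by (subst measure_pmf_bind, rule measure_pmf.measure_bind[where N = "count_space UNIV"])
       (auto simp: measure_pmf_in_subprob_algebra)
  also have "\<dots> = (\<Sum>u\<in>V. pmf p u * measure_pmf.prob (f u) A)"
    using assms by (subst integral_measure_pmf_real[of V]) (auto simp: mult.commute)
  finally show ?thesis .
qed

lemma prob_diff_le_tv_dist:
  assumes "finite V" "A \<subseteq> V"
  shows "\<bar>measure_pmf.prob P A - measure_pmf.prob Q A\<bar> \<le> tv_dist V P Q"
  unfolding tv_dist_def using assms by (intro Max_ge) auto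

text \<open>\<open>degree_pos\<close> makes every neighbourhood of a vertex nonempty, so the
  unspecified value \<open>pmf_of_set {}\<close> never enters a walk started in the graph.\<close>

locale regular_pair_graph = pair_graph G for G :: "'a pair_pre_digraph" +
  fixes D :: nat
  assumes reg: "regular G D" and degree_pos: "D \<ge> 1"
begin

lemma neighbours_subset: "neighbours G v \<subseteq> pverts G"
  by (auto simp: neighbours_def dest: in_arcsD2)

lemma finite_neighbours: "finite (neighbours G v)"
  using neighbours_subset finite_verts by (rule finite_subset)

lemma card_neighbours: "v \<in> pverts G \<Longrightarrow> card (neighbours G v) = D"
  using reg by (simp add: regular_def)

lemma neighbours_nonempty: "v \<in> pverts G \<Longrightarrow> neighbours G v \<noteq> {}"
  using card_neighbours[of v] degree_pos by auto

lemma neighbours_sym: "u \<in> neighbours G v \<longleftrightarrow> v \<in> neighbours G u"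
  by (auto simp: neighbours_def intro: arcs_symmetric)

lemma prob_step:
  assumes "u \<in> pverts G"
  shows "measure_pmf.prob (pmf_of_set (neighbours G u)) Y = card (neighbours G u \<inter> Y) / D"
  using assms by (simp add: measure_pmf_of_set finite_neighbours neighbours_nonempty card_neighbours)

lemma set_walk_pmf_subset:
  assumes "v \<in> pverts G"
  shows "set_pmf (walk_pmf G t v) \<subseteq> pverts G"
proof (induction t)
  case (Suc t)
  have "set_pmf (pmf_of_set (neighbours G u)) \<subseteq> pverts G" if "u \<in> pverts G" for u
    using that neighbours_subset by (simp add: set_pmf_of_set neighbours_nonempty finite_neighbours)
  with Suc show ?case by (auto simp: set_bind_pmf)
qed (use assms in simp)

lemma prob_walk_Suc:
  assumes "v \<in> pverts G"
  shows "measure_pmf.prob (walk_pmf G (Suc t) v) Y =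
    (\<Sum>u\<in>pverts G. pmf (walk_pmf G t v) u * (card (neighbours G u \<inter> Y) / D))"
  by (simp add: measure_bind_pmf_finite[OF finite_verts set_walk_pmf_subset[OF assms]] prob_step)

text \<open>Stationarity of the uniform distribution, scaled by the number of vertices: the one-step
  matrix of a regular graph is symmetric, hence doubly stochastic, and so are its powers. The
  induction conditions on the last step.\<close>

lemma walk_uniform_stationary:
  assumes "w \<in> pverts G"
  shows "(\<Sum>v\<in>pverts G. pmf (walk_pmf G t v) w) = 1"
  using assms
proof (induction t arbitrary: w)
  case 0
  have "(\<Sum>v\<in>pverts G. pmf (walk_pmf G 0 v) w) = (\<Sum>v\<in>pverts G. if v = w then 1 else 0)"
    by (intro sum.cong) (auto simp: indicator_def)
  then show ?case using 0 finite_verts by simp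
next
  case (Suc t)
  have "(\<Sum>v\<in>pverts G. pmf (walk_pmf G (Suc t) v) w) =
      (\<Sum>v\<in>pverts G. \<Sum>u\<in>pverts G. pmf (walk_pmf G t v) u * (card (neighbours G u \<inter> {w}) / D))"
    using prob_walk_Suc[of _ t "{w}"] by (intro sum.cong) (auto simp: measure_pmf_single)
  also have "\<dots> = (\<Sum>u\<in>pverts G. (\<Sum>v\<in>pverts G. pmf (walk_pmf G t v) u) *
      (card (neighbours G u \<inter> {w}) / D))"
    by (subst sum.swap) (simp only: sum_distrib_right)
  also have "\<dots> = (\<Sum>u\<in>pverts G. card (neighbours G u \<inter> {w}) / D)"
    using Suc.IH by (intro sum.cong) auto
  \<comment> \<open>Symmetry of adjacency turns the steps into \<open>w\<close> into neighbours of
    \<open>w\<close>, of which there are exactly \<open>D\<close>.\<close>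
  also have "\<dots> = (\<Sum>u\<in>pverts G. if u \<in> neighbours G w then 1 / D else 0)"
    by (intro sum.cong) (auto simp: neighbours_sym[of w])
  also have "\<dots> = 1"
    using finite_verts neighbours_subset[of w] card_neighbours[OF Suc.prems] degree_pos
    by (simp add: sum.If_cases Int_absorb1)
  finally show ?case .
qed

text \<open>As \<open>X\<close> and \<open>Y\<close> are disjoint, each crossing edge has exactly
  one orientation from \<open>X\<close> to \<open>Y\<close>, so it is represented by a single
  arc.\<close>

lemma edges_between_eq_card_arcs:
  assumes "X \<inter> Y = {}"
  shows "edges_between G X Y = card (parcs G \<inter> X \<times> Y)"
proof -
  let ?h = "\<lambda>(x, y). {x, y}"
  have "{e \<in> ugraph_edges G. \<exists>x\<in>X. \<exists>y\<in>Y. e = {x, y}} = ?h ` (parcs G \<inter> X \<times> Y)"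
  proof (intro equalityI subsetI)
    fix e assume "e \<in> {e \<in> ugraph_edges G. \<exists>x\<in>X. \<exists>y\<in>Y. e = {x, y}}"
    then obtain u v x y where "(u, v) \<in> parcs G" "x \<in> X" "y \<in> Y" "e = {x, y}" "{u, v} = {x, y}"
      by (auto simp: ugraph_edges_def)
    then have "(x, y) \<in> parcs G \<inter> X \<times> Y"
      using arcs_symmetric by (auto simp: doubleton_eq_iff)
    then show "e \<in> ?h ` (parcs G \<inter> X \<times> Y)"
      using \<open>e = {x, y}\<close> by (intro image_eqI[of _ _ "(x, y)"]) auto
  qed (auto simp: ugraph_edges_def)
  moreover have "inj_on ?h (parcs G \<inter> X \<times> Y)"
    using assms by (auto simp: inj_on_def doubleton_eq_iff)
  ultimately show ?thesis
    by (simp add: edges_between_def card_image)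
qed

lemma edges_between_eq_sum:
  assumes "X \<subseteq> pverts G" "X \<inter> Y = {}"
  shows "edges_between G X Y = (\<Sum>u\<in>X. card (neighbours G u \<inter> Y))"
proof -
  have "parcs G \<inter> X \<times> Y = (SIGMA u:X. neighbours G u \<inter> Y)"
    by (auto simp: neighbours_def)
  moreover have "finite X"
    using assms finite_verts finite_subset by blast
  ultimately show ?thesis
    using assms by (simp add: edges_between_eq_card_arcs card_SigmaI finite_neighbours)
qed

lemma edges_between_commute: "edges_between G X Y = edges_between G Y X"
proof -
  have "(\<exists>x\<in>X. \<exists>y\<in>Y. e = {x, y}) \<longleftrightarrow> (\<exists>y\<in>Y. \<exists>x\<in>X. e = {y, x})" for e
    by (auto simp: insert_commute)
  then show ?thesis by (simp add: edges_between_def)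
qed

text \<open>A walk from \<open>X\<close> that is outside after \<open>t + 1\<close> steps either was
  outside after \<open>t\<close> steps or crosses the cut in the last step. Each further step thus
  adds at most \<open>e(X, V - X) / D\<close>.\<close>

lemma crossing_prob_le:
  assumes "X \<subseteq> pverts G"
  shows "(\<Sum>v\<in>X. measure_pmf.prob (walk_pmf G t v) (pverts G - X)) \<le>
    t * edges_between G X (pverts G - X) / D"
proof (induction t)
  case 0
  then show ?case by (auto intro!: sum_nonpos simp: measure_return_pmf indicator_def)
next
  case (Suc t)
  let ?Y = "pverts G - X"
  let ?s = "\<lambda>u. card (neighbours G u \<inter> ?Y) / D"
  let ?q = "\<lambda>u. \<Sum>v\<in>X. pmf (walk_pmf G t v) u"
  have q_nonneg: "0 \<le> ?q u" for u
    by (simp add: sum_nonneg)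
  \<comment> \<open>\<open>?q u\<close> is the mass at \<open>u\<close> after \<open>t\<close> steps
    when one unit starts at each vertex of \<open>X\<close>. Starting one unit at every vertex would
    give exactly 1, by stationarity.\<close>
  have q_le_1: "?q u \<le> 1" if "u \<in> pverts G" for u
    using walk_uniform_stationary[OF that, of t] sum_mono2[OF finite_verts assms, of "\<lambda>v. pmf (walk_pmf G t v) u"]
    by simp
  have s_le_1: "?s u \<le> 1" if "u \<in> pverts G" for u
    using card_mono[OF finite_neighbours, of "neighbours G u \<inter> ?Y" u] card_neighbours[OF that] degree_pos
    by simp
  have "(\<Sum>v\<in>X. measure_pmf.prob (walk_pmf G (Suc t) v) ?Y) =
      (\<Sum>v\<in>X. \<Sum>u\<in>pverts G. pmf (walk_pmf G t v) u * ?s u)"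
    using assms by (intro sum.cong refl prob_walk_Suc) auto
  also have "\<dots> = (\<Sum>u\<in>pverts G. ?q u * ?s u)"
    by (subst sum.swap) (simp only: sum_distrib_right)
  also have "\<dots> = (\<Sum>u\<in>?Y. ?q u * ?s u) + (\<Sum>u\<in>X. ?q u * ?s u)"
    using assms finite_verts by (rule sum.subset_diff)
  \<comment> \<open>Outside \<open>X\<close> the step probability is bounded by 1, which leaves the
    induction hypothesis; inside \<open>X\<close> the mass is bounded by 1, which leaves the arcs
    across the cut.\<close>
  also have "\<dots> \<le> (\<Sum>u\<in>?Y. ?q u) + (\<Sum>u\<in>X. ?s u)"
  proof (intro add_mono sum_mono)
    show "?q u * ?s u \<le> ?q u" if "u \<in> ?Y" for u
      using that s_le_1 q_nonneg by (intro mult_left_le) auto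
    show "?q u * ?s u \<le> ?s u" if "u \<in> X" for u
      using that assms q_le_1 q_nonneg by (intro mult_left_le_one_le) auto
  qed
  also have "(\<Sum>u\<in>?Y. ?q u) = (\<Sum>v\<in>X. measure_pmf.prob (walk_pmf G t v) ?Y)"
    using finite_verts by (subst sum.swap) (simp add: measure_measure_pmf_finite)
  also have "(\<Sum>u\<in>X. ?s u) = edges_between G X ?Y / D"
    using assms by (subst edges_between_eq_sum) (auto simp: sum_divide_distrib)
  finally show ?case
    using Suc by (simp add: add_divide_distrib algebra_simps)
qed

end

theorem theorem3p1:
  fixes \<epsilon> \<delta> :: real and \<tau> D n :: nat and \<Gamma> :: "'a pair_pre_digraph" and X :: "'a set"
  assumes "0 < \<epsilon>" and "\<epsilon> < 2 / 5"
    and "0 < \<delta>" and "\<delta> \<le> 1 / 20"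
    and "\<tau> > 0" and "D \<ge> 1"
    and "pair_graph \<Gamma>"
    and "Digraph_Component.connected (with_proj \<Gamma>)"
    and "regular \<Gamma> D"
    and "card (pverts \<Gamma>) = n"
    and "real (card {v \<in> pverts \<Gamma>.
           tv_dist (pverts \<Gamma>) (walk_pmf \<Gamma> \<tau> v) (pmf_of_set (pverts \<Gamma>)) < 2 * \<delta>})
         \<ge> \<epsilon> * real n"
    and "X \<subseteq> pverts \<Gamma>"
    and "4 * \<delta> * real n \<le> real (card X)" and "real (card X) \<le> 1 / 2 * real n"
  shows "real (edges_between \<Gamma> X (pverts \<Gamma> - X)) \<ge> \<epsilon> * real D / (8 * real \<tau>) * real (card X)"
proof (cases "n = 0")
  case True
  then have "card X = 0"
    using assms(14) by simp
  then show ?thesis by simp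
next
  case False
  interpret regular_pair_graph \<Gamma> D
    using assms by (intro regular_pair_graph.intro regular_pair_graph_axioms.intro)
  let ?V = "pverts \<Gamma>"
  let ?Y = "?V - X"
  let ?Q = "\<lambda>v. measure_pmf.prob (walk_pmf \<Gamma> \<tau> v)"
  let ?e = "real (edges_between \<Gamma> X ?Y)"
  define p where "p = real (card X) / n"
  define S where "S = {v \<in> ?V. tv_dist ?V (walk_pmf \<Gamma> \<tau> v) (pmf_of_set ?V) < 2 * \<delta>}"
  have n_pos: "real n > 0" and V_ne: "?V \<noteq> {}"
    using False assms(10) by auto
  have p: "4 * \<delta> \<le> p" "p \<le> 1 / 2"
    using assms n_pos by (auto simp: p_def field_simps)
  have unif: "measure_pmf.prob (pmf_of_set ?V) X = p"
    using assms V_ne finite_verts by (simp add: measure_pmf_of_set p_def Int_absorb1)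
  have near: "\<bar>?Q v X - p\<bar> < 2 * \<delta>" if "v \<in> S" for v
    using that prob_diff_le_tv_dist[OF finite_verts assms(12), of "walk_pmf \<Gamma> \<tau> v" "pmf_of_set ?V"]
    by (auto simp: S_def unif)
  have compl: "?Q v X + ?Q v ?Y = 1" if "v \<in> ?V" for v
  proof -
    have "?Q v ?V = 1"
      using set_walk_pmf_subset[OF that] by (simp add: measure_pmf.prob_eq_1 AE_measure_pmf_iff subset_iff)
    then show ?thesis
      using measure_pmf.finite_measure_Diff[of ?V "walk_pmf \<Gamma> \<tau> v" X] assms(12) by simp
  qed
  have S_sub: "S \<subseteq> ?V"
    by (auto simp: S_def)
  have finS: "finite S"
    using S_sub finite_verts finite_subset by blast
  \<comment> \<open>The error is below \<open>2 * \<delta>\<close>, which is at most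
    \<open>p / 2\<close>. So \<open>X\<close> gets more than \<open>p / 2\<close>, and
    \<open>?Y\<close> more than \<open>1 - 3 * p / 2\<close>, which is at least \<open>p / 2\<close>
    because \<open>p \<le> 1 / 2\<close>.\<close>
  have in_X: "p / 2 \<le> ?Q v ?Y" and in_Y: "p / 2 \<le> ?Q v X" if "v \<in> S" for v
    using near[OF that] compl[of v] that S_sub p by auto
  have "\<epsilon> * n * (p / 2) \<le> card S * (p / 2)"
    using assms(11) p assms(3) by (intro mult_right_mono) (auto simp: S_def)
  also have "\<dots> = card (S \<inter> X) * (p / 2) + card (S \<inter> ?Y) * (p / 2)"
  proof -
    have "S = (S \<inter> X) \<union> (S \<inter> ?Y)"
      using S_sub by auto
    then have "card S = card (S \<inter> X) + card (S \<inter> ?Y)"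
      using finS by (subst card_Un_disjoint[symmetric]) auto
    then show ?thesis by (simp add: algebra_simps)
  qed
  \<comment> \<open>Each vertex of \<open>S\<close> is charged with the probability of ending on the
    side opposite to its own.\<close>
  also have "\<dots> \<le> (\<Sum>v\<in>S \<inter> X. ?Q v ?Y) + (\<Sum>v\<in>S \<inter> ?Y. ?Q v X)"
    using in_X in_Y by (intro add_mono sum_bounded_below) auto
  also have "\<dots> \<le> (\<Sum>v\<in>X. ?Q v ?Y) + (\<Sum>v\<in>?Y. ?Q v X)"
    using assms(12) finite_verts by (intro add_mono sum_mono2) (auto intro: finite_subset)
  also have "\<dots> \<le> \<tau> * ?e / D + \<tau> * ?e / D"
  proof (intro add_mono)
    show "(\<Sum>v\<in>X. ?Q v ?Y) \<le> \<tau> * ?e / D"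
      using crossing_prob_le[OF assms(12)] by simp
    \<comment> \<open>The crossing bound for \<open>?Y\<close> concerns walks ending in its
      complement, which is \<open>X\<close>; the cut is the same.\<close>
    have "?V - ?Y = X"
      using assms(12) by auto
    then show "(\<Sum>v\<in>?Y. ?Q v X) \<le> \<tau> * ?e / D"
      using crossing_prob_le[of ?Y \<tau>] edges_between_commute[of ?Y X] by simp
  qed
  finally have "\<epsilon> * card X / 2 \<le> 2 * (\<tau> * ?e / D)"
    using n_pos by (simp add: p_def)
  then have "\<epsilon> * D * card X \<le> 4 * \<tau> * ?e"
    using assms(6) by (simp add: field_simps)
  \<comment> \<open>The argument yields the constant 4; it is relaxed to the stated 8.\<close>
  also have "\<dots> \<le> 8 * \<tau> * ?e"
    by (intro mult_right_mono) auto
  finally show ?thesis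
    using assms(5) by (simp add: field_simps)
qed

end
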